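(* Let $\mathcal{A}$ be a unital $C^*$-algebra over $\mathbb{F}$, where $\mathbb{F}=\mathbb{R}$ or $\mathbb{C}$. Let $a\in\mathcal{A}$ and let $\mathcal{B}$ be a subspace of $\mathcal{A}$. Then $a$ is Birkhoff-James orthogonal to $\mathcal{B}$ if and only if $a^*a$ is Birkhoff-James orthogonal to $a^*\mathcal{B}$.
   Context: "Subspace" means $\mathbb{F}$-linear subspace (not assumed closed). For $c\in\mathcal{A}$ and a subspace $\mathcal{C}$ of $\mathcal{A}$, $c$ is Birkhoff-James orthogonal to $\mathcal{C}$ if $\|c\|\le\|c+d\|$ for all $d\in\mathcal{C}$. $a^*\mathcal{B}=\{a^*b: b\in\mathcal{B}\}$. *)

theory Defs
  imports "HOL-Analysis.Analysis"
begin

text \<open>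
  The carrier is a type of sort \<open>{real_normed_algebra, banach, monoid_mult}\<close>, that is, a unital
  Banach algebra.  Compared with \<open>real_normed_algebra_1\<close> this does not exclude the zero algebra;
  in a nonzero algebra \<open>norm 1 = 1\<close> follows from the C*-identity.  That the involution is
  isometric likewise follows from the C*-identity and submultiplicativity of the norm.
\<close>

locale cstar_involution =
  fixes star :: "'a :: {real_normed_algebra, banach, monoid_mult} \<Rightarrow> 'a"
  assumes star_add: "star (x + y) = star x + star y"
    and star_mult: "star (x * y) = star y * star x"
    and star_star: "star (star x) = x"
    and cstar_identity: "norm (star x * x) = (norm x)\<^sup>2"

text \<open>
  Over the reals the C*-identity alone does not characterise C*-algebras (consider the complex
  numbers as a real algebra with the identity as involution), so the standard definition
  additionally requires every \<open>1 + x\<^sup>*x\<close> to be invertible.  Over the complex numbers this is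
  automatic and is not part of the definition.
\<close>

locale unital_real_cstar_algebra = cstar_involution star
  for star :: "'a :: {real_normed_algebra, banach, monoid_mult} \<Rightarrow> 'a" +
  assumes star_scaleR: "star (r *\<^sub>R x) = r *\<^sub>R star x"
    and one_plus_star_mult_invertible:
      "\<exists>y. y * (1 + star x * x) = 1 \<and> (1 + star x * x) * y = 1"

text \<open>
  There is no complex counterpart of \<open>real_normed_algebra\<close> in the library, so complex scalar
  multiplication is a locale parameter, required to extend \<open>scaleR\<close>.
\<close>

locale unital_complex_cstar_algebra = cstar_involution star + vector_space scaleC
  for scaleC :: "complex \<Rightarrow> 'a :: {real_normed_algebra, banach, monoid_mult} \<Rightarrow> 'a"
    and star :: "'a \<Rightarrow> 'a" +
  assumes scaleC_of_real: "scaleC (complex_of_real r) x = r *\<^sub>R x"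
    and norm_scaleC: "norm (scaleC c x) = cmod c * norm x"
    and mult_scaleC_left: "scaleC c x * y = scaleC c (x * y)"
    and mult_scaleC_right: "x * scaleC c y = scaleC c (x * y)"
    and star_scaleC: "star (scaleC c x) = scaleC (cnj c) (star x)"

definition birkhoff_james_orthogonal :: "'a :: real_normed_vector \<Rightarrow> 'a set \<Rightarrow> bool"
  where "birkhoff_james_orthogonal c C \<longleftrightarrow> (\<forall>d\<in>C. norm c \<le> norm (c + d))"

end

theory Submission
  imports Defs
begin

text \<open>
  Put \<open>c = a + b\<close>.  If \<open>a\<^sup>*a\<close> is orthogonal to \<open>a\<^sup>*b\<close>, then
  \<open>\<parallel>a\<parallel>\<^sup>2 = \<parallel>a\<^sup>*a\<parallel> \<le> \<parallel>a\<^sup>*c\<parallel> \<le> \<parallel>a\<parallel> \<parallel>c\<parallel>\<close>.  Conversely, expanding the C*-identity for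
  \<open>a + tb = (1 - t)a + tc\<close> bounds \<open>\<parallel>a + tb\<parallel>\<^sup>2\<close> by
  \<open>(1 - t)\<^sup>2\<parallel>a\<parallel>\<^sup>2 + 2t(1 - t)\<parallel>a\<^sup>*c\<parallel> + t\<^sup>2\<parallel>c\<parallel>\<^sup>2\<close>, whose derivative at \<open>t = 0\<close> is
  \<open>2(\<parallel>a\<^sup>*c\<parallel> - \<parallel>a\<parallel>\<^sup>2)\<close>.  If \<open>\<parallel>a\<^sup>*c\<parallel> < \<parallel>a\<^sup>*a\<parallel>\<close>, then \<open>\<parallel>a + tb\<parallel> < \<parallel>a\<parallel>\<close> for small \<open>t > 0\<close>.
\<close>

context cstar_involution
begin

lemma norm_le_norm_star: "norm x \<le> norm (star x)"
proof (cases "x = 0")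
  case False
  have "norm x * norm x \<le> norm (star x) * norm x"
    using norm_mult_ineq[of "star x" x] by (simp add: cstar_identity power2_eq_square)
  then show ?thesis
    using False by simp
qed simp

lemma norm_star: "norm (star x) = norm x"
  using norm_le_norm_star[of x] norm_le_norm_star[of "star x"] by (simp add: star_star)

text \<open>The two products are adjoints of each other, and the involution is isometric.\<close>

lemma norm_star_mult_commute: "norm (star y * x) = norm (star x * y)"
  using norm_star[of "star x * y"] by (simp add: star_mult star_star)

lemma norm_le_of_norm_star_mult_le:
  assumes "norm (star a * a) \<le> norm (star a * c)"
  shows "norm a \<le> norm c"
proof (cases "a = 0")
  case False
  have "norm a * norm a \<le> norm a * norm c"
    using assms norm_mult_ineq[of "star a" c]
    by (simp add: cstar_identity power2_eq_square norm_star)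
  then show ?thesis
    using False by simp
qed simp

text \<open>Taking \<open>star_scaleR\<close> as a hypothesis lets one argument serve both scalar
  fields: it is an axiom in the real case and follows from \<open>star_scaleC\<close> in the complex
  one.\<close>

lemma norm_scaleR_add_scaleR_le:
  assumes star_scaleR: "\<And>r x. star (r *\<^sub>R x) = r *\<^sub>R star x"
    and "0 \<le> s" "0 \<le> t"
  shows "(norm (s *\<^sub>R x + t *\<^sub>R y))\<^sup>2
    \<le> s\<^sup>2 * (norm x)\<^sup>2 + 2 * s * t * norm (star x * y) + t\<^sup>2 * (norm y)\<^sup>2"
proof -
  have "(norm (s *\<^sub>R x + t *\<^sub>R y))\<^sup>2
      = norm ((s\<^sup>2) *\<^sub>R (star x * x) + (s * t) *\<^sub>R (star x * y)
          + (s * t) *\<^sub>R (star y * x) + (t\<^sup>2) *\<^sub>R (star y * y))"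
    unfolding cstar_identity[of "s *\<^sub>R x + t *\<^sub>R y", symmetric]
    by (simp add: star_add star_scaleR algebra_simps power2_eq_square)
  also have "\<dots> \<le> norm ((s\<^sup>2) *\<^sub>R (star x * x)) + norm ((s * t) *\<^sub>R (star x * y))
      + norm ((s * t) *\<^sub>R (star y * x)) + norm ((t\<^sup>2) *\<^sub>R (star y * y))"
    by (intro order.trans[OF norm_triangle_ineq] add_mono order.refl)
  also have "\<dots> = s\<^sup>2 * (norm x)\<^sup>2 + 2 * s * t * norm (star x * y) + t\<^sup>2 * (norm y)\<^sup>2"
    using assms(2,3) by (simp add: cstar_identity norm_star_mult_commute[of y x])
  finally show ?thesis .
qed

lemma norm_star_mult_le_of_norm_le:
  assumes star_scaleR: "\<And>r x. star (r *\<^sub>R x) = r *\<^sub>R star x"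
    and orth: "\<And>t. norm a \<le> norm (a + t *\<^sub>R b)"
  shows "norm (star a * a) \<le> norm (star a * (a + b))"
proof (rule ccontr)
  define c p K where "c = a + b" and "p = norm (star a * c)" and "K = (norm a)\<^sup>2 + (norm c)\<^sup>2"
  \<comment> \<open>The numerator is positive and at most \<open>K\<close>, so
    \<open>0 < t < 1\<close>. The final estimate would force twice the numerator to be at most
    \<open>t * (K + 1)\<close>, which is the numerator itself.\<close>
  define t where "t = ((norm a)\<^sup>2 - p) / (K + 1)"
  assume "\<not> ?thesis"
  then have p: "p < (norm a)\<^sup>2"
    by (simp add: p_def c_def cstar_identity)
  have "0 \<le> p" and "(norm a)\<^sup>2 \<le> K" and "0 \<le> K"
    by (simp_all add: p_def K_def)
  then have t: "0 < t" "t < 1" and tK: "t * (K + 1) = (norm a)\<^sup>2 - p"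
    using p by (simp_all add: t_def field_simps)
  have "(norm a)\<^sup>2 \<le> (norm (a + t *\<^sub>R b))\<^sup>2"
    using orth by (simp add: power_mono)
  also have "a + t *\<^sub>R b = (1 - t) *\<^sub>R a + t *\<^sub>R c"
    by (simp add: c_def algebra_simps)
  also have "(norm ((1 - t) *\<^sub>R a + t *\<^sub>R c))\<^sup>2
      \<le> (1 - t)\<^sup>2 * (norm a)\<^sup>2 + 2 * (1 - t) * t * p + t\<^sup>2 * (norm c)\<^sup>2"
    unfolding p_def using t by (intro norm_scaleR_add_scaleR_le star_scaleR) auto
  finally have "0 \<le> t * (t * (K - 2 * p) - 2 * ((norm a)\<^sup>2 - p))"
    by (simp add: K_def algebra_simps power2_eq_square)
  then have "2 * ((norm a)\<^sup>2 - p) \<le> t * (K - 2 * p)"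
    using t by (simp add: zero_le_mult_iff)
  also have "\<dots> \<le> t * (K + 1)"
    using t \<open>0 \<le> p\<close> by (intro mult_left_mono) auto
  finally show False
    using p tK by simp
qed

text \<open>The forward direction tests orthogonality on all real multiples of each
  \<open>b\<close>, whence \<open>scale\<close>.\<close>

lemma birkhoff_james_orthogonal_iff_star_mult:
  assumes star_scaleR: "\<And>r x. star (r *\<^sub>R x) = r *\<^sub>R star x"
    and scale: "\<And>r b. b \<in> B \<Longrightarrow> r *\<^sub>R b \<in> B"
  shows "birkhoff_james_orthogonal a B
    \<longleftrightarrow> birkhoff_james_orthogonal (star a * a) ((\<lambda>b. star a * b) ` B)"
  unfolding birkhoff_james_orthogonal_def ball_simps distrib_left[symmetric]
  using norm_le_of_norm_star_mult_le norm_star_mult_le_of_norm_le[OF star_scaleR] scale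
  by blast

end

context unital_complex_cstar_algebra
begin

lemma star_scaleR: "star (r *\<^sub>R x) = r *\<^sub>R star x"
  by (simp flip: scaleC_of_real add: star_scaleC)

lemma subspace_scaleR: "subspace B \<Longrightarrow> b \<in> B \<Longrightarrow> r *\<^sub>R b \<in> B"
  by (simp flip: scaleC_of_real add: subspace_scale)

end

theorem theorem3p1:
  fixes star :: "'a :: {real_normed_algebra, banach, monoid_mult} \<Rightarrow> 'a"
    and scaleC :: "complex \<Rightarrow> 'a \<Rightarrow> 'a"
    and a :: 'a
    and B :: "'a set"
  assumes "(unital_real_cstar_algebra star \<and> subspace B)
         \<or> (unital_complex_cstar_algebra scaleC star \<and> module.subspace scaleC B)"
  shows "birkhoff_james_orthogonal a B
     \<longleftrightarrow> birkhoff_james_orthogonal (star a * a) ((\<lambda>b. star a * b) ` B)"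
  using assms
proof (elim disjE conjE)
  assume "unital_real_cstar_algebra star" and B: "subspace B"
  then interpret unital_real_cstar_algebra star
    by simp
  show ?thesis
    using B by (intro birkhoff_james_orthogonal_iff_star_mult star_scaleR subspace_scale)
next
  assume "unital_complex_cstar_algebra scaleC star" and B: "module.subspace scaleC B"
  then interpret unital_complex_cstar_algebra scaleC star
    by simp
  show ?thesis
    using B by (intro birkhoff_james_orthogonal_iff_star_mult star_scaleR subspace_scaleR)
qed

end
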